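(* Let $\Sigma=\{\sigma_1,\ldots,\sigma_n\}$ be a semigroup of maps on $\{1,\ldots,N\}$ and let $V$ be a finite dimensional real vector space. The bracket $$[f,g]_\Sigma:=\sum_{j=1}^n D_jf\cdot(g\circ A_{\sigma_j})-D_jg\cdot(f\circ A_{\sigma_j})$$ makes $C^\infty(V^n,V)$ a Lie algebra. Moreover, the linear map $\gamma:C^\infty(V^n,V)\to C^\infty(V^N,V^N)$ that sends $f$ to $\gamma_f$ is a Lie algebra homomorphism.
   Context: $N,n\ge 1$ are integers and $\Sigma=\{\sigma_1,\ldots,\sigma_n\}$ is a collection of $n$ distinct maps $\sigma_j:\{1,\ldots,N\}\to\{1,\ldots,N\}$. $\Sigma$ is called a semigroup if for all $1\le j_1,j_2\le n$ there is a unique $1\le j_3\le n$ with $\sigma_{j_1}\circ\sigma_{j_2}=\sigma_{j_3}$. In that case $\widetilde\sigma_j:\{1,\ldots,n\}\to\{1,\ldots,n\}$ is the map determined by $\sigma_{\widetilde\sigma_j(k)}=\sigma_j\circ\sigma_k$, and $A_{\sigma_j}:V^n\to V^n$ is the linear map $A_{\sigma_j}(X_1,\ldots,X_n)=(X_{\widetilde\sigma_1(j)},\ldots,X_{\widetilde\sigma_n(j)})$. For $f\in C^\infty(V^n,V)$ the coupled cell network vector field $\gamma_f:V^N\to V^N$ is defined by $(\gamma_f)_i(x)=f(x_{\sigma_1(i)},\ldots,x_{\sigma_n(i)})$ for $1\le i\le N$. $D_jf$ denotes the partial derivative of $f$ with respect to its $j$-th argument $X_j\in V$. The space $C^\infty(V^N,V^N)$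 carries the Lie bracket of vector fields with the convention $[F,G](x)=DF(x)\cdot G(x)-DG(x)\cdot F(x)$. *)

theory Defs
  imports "HOL-Analysis.Analysis" "HOL-Library.Function_Algebras"
begin

(* Pointwise scalar multiplication completes the pointwise addition of Function_Algebras to
   the usual real vector space of functions; C^infty spaces below are subspaces of it. *)
instantiation "fun" :: (type, real_vector) real_vector
begin

definition scaleR_fun :: "real \<Rightarrow> ('a \<Rightarrow> 'b) \<Rightarrow> 'a \<Rightarrow> 'b" where
  "scaleR_fun c f = (\<lambda>x. c *\<^sub>R f x)"

instance
  by standard (auto simp: scaleR_fun_def fun_eq_iff scaleR_add_right scaleR_add_left)

end

(* On a finite-dimensional domain, D f is of class C^k as a map into the space of linear maps
   iff x |-> D f(x) v is of class C^k for every fixed v; this keeps the recursion inside one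
   type. It is only used for finite-dimensional domains. *)
primrec Ck :: "nat \<Rightarrow> ('a::real_normed_vector \<Rightarrow> 'b::real_normed_vector) \<Rightarrow> bool" where
  "Ck 0 f \<longleftrightarrow> continuous_on UNIV f"
| "Ck (Suc k) f \<longleftrightarrow>
     (\<forall>x. f differentiable (at x)) \<and> (\<forall>v. Ck k (\<lambda>x. frechet_derivative f (at x) v))"

definition smooth_maps :: "('a::real_normed_vector \<Rightarrow> 'b::real_normed_vector) set" where
  "smooth_maps = {f. \<forall>k. Ck k f}"

locale lie_algebra =
  fixes L :: "'a::real_vector set" and br :: "'a \<Rightarrow> 'a \<Rightarrow> 'a"
  assumes subspace_carrier: "subspace L"
    and br_closed: "\<lbrakk>x \<in> L; y \<in> L\<rbrakk> \<Longrightarrow> br x y \<in> L"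
    and br_add_left: "\<lbrakk>x \<in> L; y \<in> L; z \<in> L\<rbrakk> \<Longrightarrow> br (x + y) z = br x z + br y z"
    and br_add_right: "\<lbrakk>x \<in> L; y \<in> L; z \<in> L\<rbrakk> \<Longrightarrow> br x (y + z) = br x y + br x z"
    and br_scale_left: "\<lbrakk>x \<in> L; y \<in> L\<rbrakk> \<Longrightarrow> br (c *\<^sub>R x) y = c *\<^sub>R br x y"
    and br_scale_right: "\<lbrakk>x \<in> L; y \<in> L\<rbrakk> \<Longrightarrow> br x (c *\<^sub>R y) = c *\<^sub>R br x y"
    and br_self: "x \<in> L \<Longrightarrow> br x x = 0"
    and jacobi: "\<lbrakk>x \<in> L; y \<in> L; z \<in> L\<rbrakk> \<Longrightarrow>
      br x (br y z) + br y (br z x) + br z (br x y) = 0"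

locale lie_algebra_hom = src: lie_algebra L br + tgt: lie_algebra L' br'
  for L :: "'a::real_vector set" and br and L' :: "'b::real_vector set" and br' +
  fixes \<phi> :: "'a \<Rightarrow> 'b"
  assumes hom_closed: "x \<in> L \<Longrightarrow> \<phi> x \<in> L'"
    and hom_add: "\<lbrakk>x \<in> L; y \<in> L\<rbrakk> \<Longrightarrow> \<phi> (x + y) = \<phi> x + \<phi> y"
    and hom_scale: "x \<in> L \<Longrightarrow> \<phi> (c *\<^sub>R x) = c *\<^sub>R \<phi> x"
    and hom_br: "\<lbrakk>x \<in> L; y \<in> L\<rbrakk> \<Longrightarrow> \<phi> (br x y) = br' (\<phi> x) (\<phi> y)"

(* [F, G] = DF . G - DG . F, the negative of the other common sign convention *)
definition vf_bracket ::
  "('a::real_normed_vector \<Rightarrow> 'a) \<Rightarrow> ('a \<Rightarrow> 'a) \<Rightarrow> 'a \<Rightarrow> 'a" where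
  "vf_bracket F G =
     (\<lambda>x. frechet_derivative F (at x) (G x) - frechet_derivative G (at x) (F x))"

definition partial_deriv ::
  "'n \<Rightarrow> ('v::real_normed_vector ^ 'n::finite \<Rightarrow> 'v) \<Rightarrow> 'v ^ 'n \<Rightarrow> 'v \<Rightarrow> 'v" where
  "partial_deriv j f X =
     frechet_derivative (\<lambda>t. f (\<chi> k. if k = j then t else X $ k)) (at (X $ j))"

(* The finite types 'n and 'm play the roles of {1..n} and {1..N}; a collection of
   maps is an indexed family sigma, whose distinctness (inj) is a separate hypothesis. *)
definition semigroup_family :: "('n::finite \<Rightarrow> 'm::finite \<Rightarrow> 'm) \<Rightarrow> bool" where
  "semigroup_family \<sigma> \<longleftrightarrow> (\<forall>j1 j2. \<exists>!j3. \<sigma> j1 \<circ> \<sigma> j2 = \<sigma> j3)"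

definition sigma_tilde :: "('n::finite \<Rightarrow> 'm::finite \<Rightarrow> 'm) \<Rightarrow> 'n \<Rightarrow> 'n \<Rightarrow> 'n" where
  "sigma_tilde \<sigma> j k = (THE l. \<sigma> l = \<sigma> j \<circ> \<sigma> k)"

definition A_map ::
  "('n::finite \<Rightarrow> 'm::finite \<Rightarrow> 'm) \<Rightarrow> 'n \<Rightarrow> 'v ^ 'n \<Rightarrow> 'v ^ 'n" where
  "A_map \<sigma> j X = (\<chi> i. X $ sigma_tilde \<sigma> i j)"

definition network_vf ::
  "('n::finite \<Rightarrow> 'm::finite \<Rightarrow> 'm) \<Rightarrow> ('v ^ 'n \<Rightarrow> 'v) \<Rightarrow> 'v ^ 'm \<Rightarrow> 'v ^ 'm" where
  "network_vf \<sigma> f x = (\<chi> i. f (\<chi> j. x $ \<sigma> j i))"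

definition sigma_bracket ::
  "('n::finite \<Rightarrow> 'm::finite \<Rightarrow> 'm) \<Rightarrow> ('v::real_normed_vector ^ 'n \<Rightarrow> 'v) \<Rightarrow>
   ('v ^ 'n \<Rightarrow> 'v) \<Rightarrow> 'v ^ 'n \<Rightarrow> 'v" where
  "sigma_bracket \<sigma> f g =
     (\<lambda>X. \<Sum>j\<in>UNIV. (partial_deriv j f X ((g \<circ> A_map \<sigma> j) X)
                  - partial_deriv j g X ((f \<circ> A_map \<sigma> j) X)))"

end

theory Submission
  imports Defs
begin

text \<open>Let \<open>\<Gamma> f\<close> be the network vector field of \<open>f\<close> for the family \<open>sigma_tilde \<sigma>\<close>; it is a vector
  field on \<open>V^n\<close>, that of the fundamental network. Its components are the maps
  \<open>f \<circ> A_map \<sigma> j\<close>, so the bracket of the theorem can be written without partial derivatives as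
  \<open>Df \<cdot> \<Gamma> g - Dg \<cdot> \<Gamma> f\<close> (lemma \<open>sigma_bracket_eq\<close>).

  The central computation is \<open>network_vf_sigma_bracket\<close>: for every family \<open>\<tau>\<close> that composes like
  \<open>\<sigma>\<close>, taking network vector fields sends this bracket to the bracket of vector fields, because
  the projection of \<open>V^N\<close> onto the inputs of a cell maps network vector fields to vector fields of
  the fundamental network. For \<open>\<tau> = \<sigma>\<close> this is the homomorphism property. For
  \<open>\<tau> = sigma_tilde \<sigma>\<close> it says that \<open>\<Gamma>\<close> respects brackets.

  The latter gives the Jacobi identity (lemma \<open>lie_algebra_of_representation\<close>): expand
  \<open>[f,[g,h]] = Df \<cdot> [\<Gamma> g, \<Gamma> h] - D[g,h] \<cdot> \<Gamma> f\<close> by the product rule and add cyclically; the second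
  derivatives cancel by their symmetry, everything else cancels in pairs. With \<open>\<Gamma>\<close> the identity,
  the same lemma shows that smooth vector fields form a Lie algebra.

  Two analytic facts support this. Mixed second derivatives are symmetric, by the mean value
  inequality for second differences. And \<open>x \<mapsto> Df(x) \<cdot> G(x)\<close> is smooth and obeys the product rule,
  although smoothness is defined through derivatives in fixed directions; this uses that
  the coordinates of a finite-dimensional normed space are continuous.\<close>

abbreviation D where "D f x \<equiv> frechet_derivative f (at x)"

section \<open>Bounded coordinates in finite dimension\<close>

text \<open>Adding one generator \<open>a\<close> to \<open>B\<close> replaces the box by its Minkowski sum with the
  compact segment from \<open>-a\<close> to \<open>a\<close>.\<close>

lemma compact_coordinate_box:
  fixes B :: "'a::real_normed_vector set"
  assumes "finite B"
  shows "compact ((\<lambda>u. \<Sum>b\<in>B. u b *\<^sub>R b) ` {u :: 'a \<Rightarrow> real. \<forall>b\<in>B. \<bar>u b\<bar> \<le> 1})"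
  using assms
proof (induction B)
  case empty
  have "((\<lambda>u. \<Sum>b\<in>{}. u b *\<^sub>R b) ` {u :: 'a \<Rightarrow> real. \<forall>b\<in>{}. \<bar>u b\<bar> \<le> 1}) = {0}"
    by auto
  then show ?case by (metis compact_sing)
next
  case (insert a B)
  let ?K = "\<lambda>B. (\<lambda>u. \<Sum>b\<in>B. u b *\<^sub>R b) ` {u :: 'a \<Rightarrow> real. \<forall>b\<in>B. \<bar>u b\<bar> \<le> 1}"
  have seg: "compact ((\<lambda>t. t *\<^sub>R a) ` {-1..1::real})"
    by (intro compact_continuous_image continuous_intros compact_Icc)
  have "?K (insert a B) = {x + y | x y. x \<in> (\<lambda>t. t *\<^sub>R a) ` {-1..1::real} \<and> y \<in> ?K B}"
  proof (intro equalityI subsetI)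
    fix z assume "z \<in> ?K (insert a B)"
    then obtain u where u: "\<forall>b\<in>insert a B. \<bar>u b\<bar> \<le> 1" "z = (\<Sum>b\<in>insert a B. u b *\<^sub>R b)"
      by auto
    have "z = u a *\<^sub>R a + (\<Sum>b\<in>B. u b *\<^sub>R b)"
      using u insert by simp
    moreover have "u a \<in> {-1..1}" using u by (auto simp: abs_le_iff)
    ultimately show "z \<in> {x + y | x y. x \<in> (\<lambda>t. t *\<^sub>R a) ` {-1..1::real} \<and> y \<in> ?K B}"
      using u by blast
  next
    fix z assume "z \<in> {x + y | x y. x \<in> (\<lambda>t. t *\<^sub>R a) ` {-1..1::real} \<and> y \<in> ?K B}"
    then obtain t u where tu: "t \<in> {-1..1}" "\<forall>b\<in>B. \<bar>u b\<bar> \<le> 1"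
      "z = t *\<^sub>R a + (\<Sum>b\<in>B. u b *\<^sub>R b)" by auto
    have "(\<Sum>b\<in>B. (u(a:=t)) b *\<^sub>R b) = (\<Sum>b\<in>B. u b *\<^sub>R b)"
      using insert by (intro sum.cong) auto
    then have "z = (\<Sum>b\<in>insert a B. (u(a:=t)) b *\<^sub>R b)"
      using tu insert by simp
    moreover have "\<forall>b\<in>insert a B. \<bar>(u(a:=t)) b\<bar> \<le> 1"
      using tu by auto
    ultimately show "z \<in> ?K (insert a B)" by blast
  qed
  then show ?case using compact_sums[OF seg insert.IH] by simp
qed

text \<open>After division by a coefficient of largest modulus, a nonzero combination of \<open>B\<close>
  lies in one of the finitely many sets \<open>b + K\<close>, where \<open>K\<close> is the coordinate box of \<open>B - {b}\<close>.
  Each of them is closed and, by independence, misses the origin. Hence they all stay at some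
  positive distance \<open>e\<close> from it, and \<open>1/e\<close> is the required constant.\<close>

lemma coordinates_bounded:
  fixes B :: "'a::real_normed_vector set"
  assumes fin: "finite B" and ind: "independent B"
  shows "\<exists>C\<ge>0. \<forall>u b. b \<in> B \<longrightarrow> \<bar>u b\<bar> \<le> C * norm (\<Sum>b\<in>B. u b *\<^sub>R b)"
proof -
  let ?K = "\<lambda>B. (\<lambda>u. \<Sum>b\<in>B. u b *\<^sub>R b) ` {u :: 'a \<Rightarrow> real. \<forall>b\<in>B. \<bar>u b\<bar> \<le> 1}"
  have "\<exists>d>0. \<forall>y\<in>?K (B - {b}). d \<le> norm (b + y)" if b: "b \<in> B" for b
  proof -
    have "- b \<notin> span (B - {b})"
      using ind b span_neg[of "- b" "B - {b}"] by (auto simp: dependent_def)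
    moreover have "?K (B - {b}) \<subseteq> span (B - {b})"
      by (clarify, intro span_sum span_scale span_base)
    ultimately have "- b \<notin> ?K (B - {b})" by blast
    moreover have cl: "closed (?K (B - {b}))"
      using compact_coordinate_box[of "B - {b}"] fin by (simp add: compact_imp_closed)
    ultimately obtain d where d: "d > 0" "ball (- b) d \<subseteq> - ?K (B - {b})"
      using openE[of "- ?K (B - {b})" "- b"] open_Compl[OF cl] by auto
    have "d \<le> norm (b + y)" if "y \<in> ?K (B - {b})" for y
    proof -
      have "y \<notin> ball (- b) d" using d(2) that by blast
      then have "d \<le> dist (- b) y" by simp
      also have "\<dots> = norm (b + y)"
        by (metis dist_minus dist_norm minus_minus diff_minus_eq_add)
      finally show ?thesis .
    qed
    then show ?thesis using d(1) by blast
  qed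
  then have "\<forall>b\<in>B. \<exists>d. d > 0 \<and> (\<forall>y\<in>?K (B - {b}). d \<le> norm (b + y))"
    by blast
  from bchoice[OF this] obtain d
    where dd: "\<forall>b\<in>B. d b > 0 \<and> (\<forall>y\<in>?K (B - {b}). d b \<le> norm (b + y))"
    by blast
  then have d: "\<And>b. b \<in> B \<Longrightarrow> d b > 0"
      "\<And>b y. b \<in> B \<Longrightarrow> y \<in> ?K (B - {b}) \<Longrightarrow> d b \<le> norm (b + y)"
    by blast+
  define e where "e = Min (insert 1 (d ` B))"
  have e: "e > 0" "\<And>b. b \<in> B \<Longrightarrow> e \<le> d b"
    using fin d(1) by (auto simp: e_def)
  have "\<bar>u b\<bar> \<le> 1 / e * norm (\<Sum>b\<in>B. u b *\<^sub>R b)" if b: "b \<in> B" for u b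
  proof -
    define M where "M = Max ((\<lambda>b. \<bar>u b\<bar>) ` B)"
    have M: "\<And>c. c \<in> B \<Longrightarrow> \<bar>u c\<bar> \<le> M" using fin by (simp add: M_def)
    have "M \<in> (\<lambda>b. \<bar>u b\<bar>) ` B"
      unfolding M_def using fin b by (intro Max_in) auto
    then obtain c where c: "c \<in> B" "\<bar>u c\<bar> = M" by auto
    have "M \<le> 1 / e * norm (\<Sum>b\<in>B. u b *\<^sub>R b)"
    proof (cases "M = 0")
      case True
      then show ?thesis using e by simp
    next
      case False
      then have Mp: "M > 0" and uc: "u c \<noteq> 0" using c by auto
      define y where "y = (\<Sum>b\<in>B - {c}. (u b / u c) *\<^sub>R b)"
      have "y \<in> ?K (B - {c})"
        unfolding y_def using M c uc
        by (intro imageI) (auto simp: divide_simps)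
      then have "e \<le> norm (c + y)" using d(2)[OF c(1)] e(2)[OF c(1)] by fastforce
      moreover have "(\<Sum>b\<in>B. u b *\<^sub>R b) = u c *\<^sub>R (c + y)"
        using fin c uc by (simp add: sum.remove[of B c] y_def scaleR_add_right scaleR_sum_right)
      ultimately have "norm (\<Sum>b\<in>B. u b *\<^sub>R b) \<ge> M * e"
        using c Mp by (simp add: mult_left_mono)
      then show ?thesis using e(1) by (simp add: field_simps)
    qed
    then show ?thesis using M[OF b] by linarith
  qed
  then show ?thesis using e(1) by (intro exI[of _ "1/e"]) auto
qed

text \<open>A finite spanning set in a normed space gives a basis without any orthogonality, so the
  continuity of its dual functionals \<open>r b\<close> needs an argument: it is the bound on coefficients
  just obtained.\<close>

lemma bounded_coordinates_exist:
  assumes "\<exists>B :: 'a::real_normed_vector set. finite B \<and> span B = UNIV"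
  shows "\<exists>(B :: 'a set) r. finite B \<and> (\<forall>b\<in>B. bounded_linear (r b)) \<and>
           (\<forall>x. (\<Sum>b\<in>B. r b x *\<^sub>R b) = x)"
proof -
  obtain S :: "'a set" where S: "finite S" "span S = UNIV" using assms by blast
  obtain B where B: "B \<subseteq> S" "independent B" "S \<subseteq> span B"
    by (rule maximal_independent_subset)
  have fin: "finite B" using B S finite_subset by blast
  have sp: "span B = UNIV" using span_mono[OF B(3)] S(2) unfolding span_span by auto
  define r where "r = (\<lambda>b x. representation B x b)"
  have rep: "(\<Sum>b\<in>B. r b x *\<^sub>R b) = x" for x
    unfolding r_def using real_vector.sum_representation_eq[OF B(2) _ fin] sp by auto
  obtain C where C: "C \<ge> 0" "\<And>u b. b \<in> B \<Longrightarrow> \<bar>u b\<bar> \<le> C * norm (\<Sum>b\<in>B. u b *\<^sub>R b)"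
    using coordinates_bounded[OF fin B(2)] by blast
  have "bounded_linear (r b)" if "b \<in> B" for b
  proof (rule bounded_linear_intro)
    show "r b (x + y) = r b x + r b y" for x y
      by (simp add: r_def real_vector.representation_add[OF B(2)] sp)
    show "r b (c *\<^sub>R x) = c *\<^sub>R r b x" for c x
      by (simp add: r_def real_vector.representation_scale[OF B(2)] sp)
    show "norm (r b x) \<le> norm x * C" for x
      using C(2)[OF that, of "\<lambda>b. r b x"] by (simp add: rep mult.commute)
  qed
  then show ?thesis using fin rep by blast
qed

section \<open>Symmetry of second derivatives\<close>

lemma norm_increment_le:
  fixes h :: "real \<Rightarrow> 'b::real_normed_vector"
  assumes der: "\<And>s. (h has_vector_derivative h' s) (at s)"
    and bnd: "\<And>s. 0 < s \<Longrightarrow> s < t \<Longrightarrow> norm (h' s) \<le> K" and "0 < t"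
  shows "norm (h t - h 0) \<le> K * t"
proof -
  have "norm (h t - h 0) \<le> K * t - K * 0"
  proof (rule differentiable_bound_general[where f = h and f' = h' and \<phi> = "\<lambda>s. K * s" and \<phi>' = "\<lambda>_. K"])
    show "continuous_on {0..t} h"
      using der by (meson continuous_at_imp_continuous_on has_vector_derivative_continuous)
    show "((*) K has_vector_derivative K) (at x)" for x
      by (auto intro!: derivative_eq_intros simp: has_real_derivative_iff_has_vector_derivative[symmetric])
  qed (use assms in \<open>auto intro!: continuous_intros\<close>)
  then show ?thesis by simp
qed

lemma has_vector_derivative_along_line:
  fixes f :: "'a::real_normed_vector \<Rightarrow> 'b::real_normed_vector"
  assumes "f differentiable (at (a + s *\<^sub>R v))"
  shows "((\<lambda>s. f (a + s *\<^sub>R v)) has_vector_derivative D f (a + s *\<^sub>R v) v) (at s)"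
proof -
  let ?y = "a + s *\<^sub>R v"
  have f: "(f has_derivative D f ?y) (at ?y)" using assms frechet_derivative_works by blast
  have l: "((\<lambda>s. a + s *\<^sub>R v) has_derivative (\<lambda>h. h *\<^sub>R v)) (at s)"
    by (auto intro!: derivative_eq_intros)
  have "((\<lambda>s. f (a + s *\<^sub>R v)) has_derivative (\<lambda>h. D f ?y (h *\<^sub>R v))) (at s)"
    using has_derivative_compose[OF l f] by simp
  then show ?thesis
    unfolding has_vector_derivative_def
    by (simp add: linear_cmul[OF linear_frechet_derivative[OF assms]])
qed

text \<open>A double application of the mean value inequality, first in direction \<open>w\<close> to the derivative
  along \<open>v\<close>, then in direction \<open>v\<close> to the difference of \<open>f\<close> across \<open>t w\<close>. The subtracted terms
  make the derivative that is being estimated the deviation of the second derivative from \<open>L\<close>.\<close>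

lemma second_difference_estimate:
  fixes f :: "'a::real_normed_vector \<Rightarrow> 'b::real_normed_vector"
  assumes f: "\<And>y. f differentiable (at y)"
    and Df: "\<And>y. (\<lambda>z. D f z v) differentiable (at y)"
    and near: "\<And>s \<tau>. \<bar>s\<bar> \<le> t \<Longrightarrow> \<bar>\<tau>\<bar> \<le> t \<Longrightarrow>
       norm (D (\<lambda>z. D f z v) (x + s *\<^sub>R v + \<tau> *\<^sub>R w) w - L) \<le> e"
    and t: "0 < t"
  shows "norm (f (x + t *\<^sub>R v + t *\<^sub>R w) - f (x + t *\<^sub>R v) - f (x + t *\<^sub>R w) + f x
           - (t * t) *\<^sub>R L) \<le> e * t * t"
proof -
  let ?g = "\<lambda>z. D f z v"
  have inner: "norm (?g (x + s *\<^sub>R v + t *\<^sub>R w) - ?g (x + s *\<^sub>R v) - t *\<^sub>R L) \<le> e * t"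
    if s: "0 < s" "s < t" for s
  proof -
    let ?h = "\<lambda>\<tau>. ?g ((x + s *\<^sub>R v) + \<tau> *\<^sub>R w) - \<tau> *\<^sub>R L"
    have "(?h has_vector_derivative D ?g ((x + s *\<^sub>R v) + \<tau> *\<^sub>R w) w - L) (at \<tau>)" for \<tau>
      by (intro has_vector_derivative_diff has_vector_derivative_along_line Df)
         (auto intro!: derivative_eq_intros)
    then have "norm (?h t - ?h 0) \<le> e * t"
      by (rule norm_increment_le) (use near s t in auto)
    then show ?thesis by (simp add: algebra_simps)
  qed
  let ?k = "\<lambda>s. f ((x + t *\<^sub>R w) + s *\<^sub>R v) - f (x + s *\<^sub>R v) - s *\<^sub>R (t *\<^sub>R L)"
  have "(?k has_vector_derivative ?g ((x + t *\<^sub>R w) + s *\<^sub>R v) - ?g (x + s *\<^sub>R v) - t *\<^sub>R L) (at s)" for s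
    by (intro has_vector_derivative_diff has_vector_derivative_along_line f)
       (auto intro!: derivative_eq_intros)
  then have "norm (?k t - ?k 0) \<le> (e * t) * t"
    by (rule norm_increment_le) (use inner t in \<open>auto simp: algebra_simps\<close>)
  then show ?thesis by (simp add: algebra_simps)
qed

text \<open>The second difference is symmetric in \<open>v\<close> and \<open>w\<close>, and divided by \<open>t * t\<close> it tends to
  either of the two mixed derivatives as \<open>t\<close> tends to zero.\<close>

lemma second_derivative_symmetric:
  fixes f :: "'a::real_normed_vector \<Rightarrow> 'b::real_normed_vector"
  assumes f: "\<And>y. f differentiable (at y)"
    and Df: "\<And>u y. (\<lambda>z. D f z u) differentiable (at y)"
    and D2f: "\<And>u u'. continuous_on UNIV (\<lambda>y. D (\<lambda>z. D f z u) y u')"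
  shows "D (\<lambda>z. D f z v) x w = D (\<lambda>z. D f z w) x v"
proof -
  let ?L = "\<lambda>v w. D (\<lambda>z. D f z v) x w"
  have near: "\<exists>t0>0. \<forall>s \<tau>. \<bar>s\<bar> \<le> t0 \<and> \<bar>\<tau>\<bar> \<le> t0 \<longrightarrow>
      norm (D (\<lambda>z. D f z v) (x + s *\<^sub>R v + \<tau> *\<^sub>R w) w - ?L v w) \<le> e" if e: "e > 0" for v w e
  proof -
    have "\<exists>d>0. \<forall>y. dist y x < d \<longrightarrow>
        dist (D (\<lambda>z. D f z v) y w) (?L v w) < e"
      using D2f[of v w] e by (auto simp: continuous_on_iff)
    then obtain d where d: "d > 0" "\<And>y. dist y x < d \<Longrightarrow>
        norm (D (\<lambda>z. D f z v) y w - ?L v w) < e"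
      by (auto simp: dist_norm)
    define t0 where "t0 = d / (norm v + norm w + 1)"
    have n: "norm v + norm w + 1 > 0" by (smt (verit) norm_ge_zero)
    have t0: "t0 > 0" using d(1) n by (simp add: t0_def)
    have "dist (x + s *\<^sub>R v + \<tau> *\<^sub>R w) x < d" if "\<bar>s\<bar> \<le> t0" "\<bar>\<tau>\<bar> \<le> t0" for s \<tau>
    proof -
      have "dist (x + s *\<^sub>R v + \<tau> *\<^sub>R w) x \<le> \<bar>s\<bar> * norm v + \<bar>\<tau>\<bar> * norm w"
        using norm_triangle_ineq[of "s *\<^sub>R v" "\<tau> *\<^sub>R w"] by (simp add: dist_norm add.assoc)
      also have "\<dots> \<le> t0 * norm v + t0 * norm w"
        using that by (intro add_mono mult_right_mono) auto
      also have "\<dots> < t0 * (norm v + norm w + 1)" using t0 by (simp add: algebra_simps)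
      also have "\<dots> = d" using n by (simp add: t0_def)
      finally show ?thesis .
    qed
    then show ?thesis using d(2) t0 by (meson less_imp_le)
  qed
  have "norm (?L v w - ?L w v) \<le> 0 + e" if e: "e > 0" for e :: real
  proof -
    obtain t1 where t1: "t1 > 0" "\<And>s \<tau>. \<bar>s\<bar> \<le> t1 \<and> \<bar>\<tau>\<bar> \<le> t1 \<Longrightarrow>
      norm (D (\<lambda>z. D f z v) (x + s *\<^sub>R v + \<tau> *\<^sub>R w) w - ?L v w) \<le> e/2"
      using near[of "e/2" v w] e by auto
    obtain t2 where t2: "t2 > 0" "\<And>s \<tau>. \<bar>s\<bar> \<le> t2 \<and> \<bar>\<tau>\<bar> \<le> t2 \<Longrightarrow>
      norm (D (\<lambda>z. D f z w) (x + s *\<^sub>R w + \<tau> *\<^sub>R v) v - ?L w v) \<le> e/2"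
      using near[of "e/2" w v] e by auto
    define t where "t = min t1 t2"
    have t: "t > 0" "t \<le> t1" "t \<le> t2" using t1 t2 by (auto simp: t_def)
    let ?S = "f (x + t *\<^sub>R v + t *\<^sub>R w) - f (x + t *\<^sub>R v) - f (x + t *\<^sub>R w) + f x"
    have 1: "norm (?S - (t * t) *\<^sub>R ?L v w) \<le> e/2 * t * t"
      by (rule second_difference_estimate) (use f Df t1 t in auto)
    have "norm (f (x + t *\<^sub>R w + t *\<^sub>R v) - f (x + t *\<^sub>R w) - f (x + t *\<^sub>R v) + f x
           - (t * t) *\<^sub>R ?L w v) \<le> e/2 * t * t"
      by (rule second_difference_estimate) (use f Df t2 t in auto)
    then have 2: "norm (?S - (t * t) *\<^sub>R ?L w v) \<le> e/2 * t * t"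
      by (simp add: algebra_simps)
    have "(t * t) * norm (?L v w - ?L w v) = norm ((t * t) *\<^sub>R (?L v w - ?L w v))"
      by simp
    also have "\<dots> = norm ((?S - (t * t) *\<^sub>R ?L w v) - (?S - (t * t) *\<^sub>R ?L v w))"
      by (simp add: algebra_simps)
    also have "\<dots> \<le> e/2 * t * t + e/2 * t * t"
      using norm_triangle_ineq4 1 2 by (meson add_mono order_trans)
    also have "\<dots> = (t * t) * e" by (simp add: algebra_simps)
    finally show ?thesis using t by simp
  qed
  then have "norm (?L v w - ?L w v) \<le> 0" by (rule field_le_epsilon)
  then show ?thesis by simp
qed

section \<open>Smooth maps\<close>

lemma D_eqI: "(f has_derivative f') (at x) \<Longrightarrow> D f x = f'"
  by (rule frechet_derivative_at[symmetric])

lemma Ck_SucI: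
  assumes "\<And>x. (f has_derivative f' x) (at x)" "\<And>v. Ck k (\<lambda>x. f' x v)"
  shows "Ck (Suc k) f"
  using assms D_eqI[OF assms(1)] by (auto simp: differentiable_def)

lemma Ck_SucD:
  assumes "Ck (Suc k) f"
  shows "(f has_derivative D f x) (at x)" "Ck k (\<lambda>x. D f x v)"
  using assms frechet_derivative_works by auto

lemma Ck_lower: "Ck (Suc k) f \<Longrightarrow> Ck k f"
proof (induction k arbitrary: f)
  case 0
  then show ?case
    by (auto intro!: continuous_at_imp_continuous_on differentiable_imp_continuous_within)
next
  case (Suc k)
  then show ?case by (metis Ck.simps(2))
qed

lemma Ck_const: "Ck k (\<lambda>x. c)"
proof (induction k arbitrary: c)
  case (Suc k)
  then show ?case by (intro Ck_SucI[where f' = "\<lambda>_ _. 0"]) auto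
qed simp

lemma Ck_add: "Ck k f \<Longrightarrow> Ck k g \<Longrightarrow> Ck k (\<lambda>x. f x + g x)"
proof (induction k arbitrary: f g)
  case (Suc k)
  show ?case
    by (rule Ck_SucI[OF has_derivative_add[OF Suc.prems[THEN Ck_SucD(1)]]])
       (intro Suc.IH Ck_SucD(2) Suc.prems)
qed (simp add: continuous_on_add)

lemma Ck_sum: "(\<And>i. i \<in> I \<Longrightarrow> Ck k (f i)) \<Longrightarrow> Ck k (\<lambda>x. \<Sum>i\<in>I. f i x)"
  by (induction I rule: infinite_finite_induct) (auto intro: Ck_add Ck_const)

lemma Ck_bounded_linear:
  assumes L: "bounded_linear L"
  shows "Ck k f \<Longrightarrow> Ck k (\<lambda>x. L (f x))"
proof (induction k arbitrary: f)
  case (Suc k)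
  show ?case
    by (rule Ck_SucI[OF bounded_linear.has_derivative[OF L Ck_SucD(1)[OF Suc.prems]]])
       (intro Suc.IH Ck_SucD(2) Suc.prems)
qed (simp add: bounded_linear.continuous_on[OF L])

lemma Ck_scaleR:
  fixes c :: "'a::real_normed_vector \<Rightarrow> real" and f :: "'a \<Rightarrow> 'b::real_normed_vector"
  shows "Ck k c \<Longrightarrow> Ck k f \<Longrightarrow> Ck k (\<lambda>x. c x *\<^sub>R f x)"
proof (induction k arbitrary: c f)
  case (Suc k)
  show ?case
    by (rule Ck_SucI[OF has_derivative_scaleR[OF Suc.prems[THEN Ck_SucD(1)]]])
       (intro Ck_add Suc.IH Suc.prems[THEN Ck_SucD(2)] Suc.prems[THEN Ck_lower])
qed (simp add: continuous_on_scaleR)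

lemma Ck_compose_linear:
  assumes L: "bounded_linear L"
  shows "Ck k f \<Longrightarrow> Ck k (\<lambda>x. f (L x))"
proof (induction k arbitrary: f)
  case 0
  have "continuous_on UNIV L"
    using L by (simp add: linear_continuous_on)
  then show ?case
    using 0 continuous_on_compose2[of UNIV f UNIV L] by simp
next
  case (Suc k)
  show ?case
  proof (rule Ck_SucI[where f' = "\<lambda>x v. D f (L x) (L v)"])
    show "((\<lambda>x. f (L x)) has_derivative (\<lambda>v. D f (L x) (L v))) (at x)" for x
      using has_derivative_compose[OF bounded_linear_imp_has_derivative[OF L]] Ck_SucD(1)[OF Suc.prems] .
    show "Ck k (\<lambda>x. D f (L x) (L v))" for v
      by (intro Suc.IH Ck_SucD Suc.prems)
  qed
qed

lemma smooth_mapsD: "f \<in> smooth_maps \<Longrightarrow> Ck k f"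
  by (simp add: smooth_maps_def)

lemma smooth_has_derivative: "f \<in> smooth_maps \<Longrightarrow> (f has_derivative D f x) (at x)"
  using Ck_SucD(1) smooth_mapsD by blast

lemma smooth_linear_D: "f \<in> smooth_maps \<Longrightarrow> linear (D f x)"
  using smooth_has_derivative has_derivative_linear by blast

lemma smooth_directional: "f \<in> smooth_maps \<Longrightarrow> (\<lambda>x. D f x v) \<in> smooth_maps"
  unfolding smooth_maps_def using Ck_SucD(2)[of _ f v] by blast

lemma smooth_add: "f \<in> smooth_maps \<Longrightarrow> g \<in> smooth_maps \<Longrightarrow> (\<lambda>x. f x + g x) \<in> smooth_maps"
  by (simp add: smooth_maps_def Ck_add)

lemma smooth_sum:
  "(\<And>i. i \<in> I \<Longrightarrow> f i \<in> smooth_maps) \<Longrightarrow> (\<lambda>x. \<Sum>i\<in>I. f i x) \<in> smooth_maps"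
  by (simp add: smooth_maps_def Ck_sum)

lemma smooth_bounded_linear:
  "bounded_linear L \<Longrightarrow> f \<in> smooth_maps \<Longrightarrow> (\<lambda>x. L (f x)) \<in> smooth_maps"
  by (simp add: smooth_maps_def Ck_bounded_linear)

lemma smooth_compose_linear:
  "bounded_linear L \<Longrightarrow> f \<in> smooth_maps \<Longrightarrow> (\<lambda>x. f (L x)) \<in> smooth_maps"
  by (simp add: smooth_maps_def Ck_compose_linear)

lemma smooth_scaleR:
  fixes f :: "'a::real_normed_vector \<Rightarrow> 'b::real_normed_vector"
  shows "c \<in> smooth_maps \<Longrightarrow> f \<in> smooth_maps \<Longrightarrow> (\<lambda>x. c x *\<^sub>R f x) \<in> smooth_maps"
  by (simp add: smooth_maps_def Ck_scaleR)

lemma smooth_diff: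
  assumes "f \<in> smooth_maps" "g \<in> smooth_maps"
  shows "(\<lambda>x. f x - g x) \<in> smooth_maps"
  using smooth_add[OF assms(1) smooth_bounded_linear[OF bounded_linear_minus[OF bounded_linear_ident] assms(2)]]
  by simp

lemma subspace_smooth_maps:
  "subspace (smooth_maps :: ('a::real_normed_vector \<Rightarrow> 'b::real_normed_vector) set)"
proof (rule subspaceI)
  show "0 \<in> (smooth_maps :: ('a \<Rightarrow> 'b) set)"
    unfolding zero_fun_def by (simp add: smooth_maps_def Ck_const)
  show "f + g \<in> smooth_maps" if "f \<in> smooth_maps" "g \<in> smooth_maps" for f g :: "'a \<Rightarrow> 'b"
    unfolding plus_fun_def using that by (rule smooth_add)
  show "c *\<^sub>R f \<in> smooth_maps" if "f \<in> smooth_maps" for c and f :: "'a \<Rightarrow> 'b"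
    unfolding scaleR_fun_def using bounded_linear_scaleR_right that by (rule smooth_bounded_linear)
qed

lemma D_add:
  assumes "f \<in> smooth_maps" "g \<in> smooth_maps"
  shows "D (f + g) x v = D f x v + D g x v"
  using D_eqI[OF has_derivative_add[OF assms[THEN smooth_has_derivative]]]
  by (simp add: plus_fun_def)

lemma D_scaleR:
  assumes "f \<in> smooth_maps"
  shows "D (c *\<^sub>R f) x v = c *\<^sub>R D f x v"
  using D_eqI[OF has_derivative_scaleR_right[OF assms[THEN smooth_has_derivative]]]
  by (simp add: scaleR_fun_def)

text \<open>In bounded coordinates, the derivative of \<open>f\<close> along a vector field \<open>G\<close> is a finite sum of
  products of a smooth scalar function, a coordinate of \<open>G\<close>, with a smooth derivative of \<open>f\<close> in a
  fixed direction. Both smoothness and the product rule can be read off from that sum. In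
  its derivative, the first summand is the second derivative of \<open>f\<close>, with the value \<open>G x\<close>
  frozen.\<close>

lemma
  fixes f :: "'a::real_normed_vector \<Rightarrow> 'b::real_normed_vector"
  assumes fd: "\<exists>B :: 'a set. finite B \<and> span B = UNIV"
    and f: "f \<in> smooth_maps" and G: "G \<in> smooth_maps"
  shows smooth_along_field: "(\<lambda>x. D f x (G x)) \<in> smooth_maps"
    and has_derivative_along_field:
      "((\<lambda>y. D f y (G y)) has_derivative (\<lambda>v. D (\<lambda>z. D f z (G x)) x v + D f x (D G x v))) (at x)"
proof -
  obtain B :: "'a set" and r where fin: "finite B"
    and bl: "\<And>b. b \<in> B \<Longrightarrow> bounded_linear (r b)"
    and rep: "\<And>x. (\<Sum>b\<in>B. r b x *\<^sub>R b) = x"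
    using bounded_coordinates_exist[OF fd] by metis
  have expand: "D f z w = (\<Sum>b\<in>B. r b w *\<^sub>R D f z b)" for z w
  proof -
    have "D f z w = D f z (\<Sum>b\<in>B. r b w *\<^sub>R b)" by (simp add: rep)
    also have "\<dots> = (\<Sum>b\<in>B. r b w *\<^sub>R D f z b)"
      using smooth_linear_D[OF f] by (simp add: linear_sum linear_cmul)
    finally show ?thesis .
  qed
  have eq: "(\<lambda>y. D f y (G y)) = (\<lambda>y. \<Sum>b\<in>B. r b (G y) *\<^sub>R D f y b)"
    using expand by blast
  show "(\<lambda>x. D f x (G x)) \<in> smooth_maps"
    unfolding eq using bl G f
    by (intro smooth_sum smooth_scaleR smooth_bounded_linear[of "r _" G] smooth_directional)
  have Df: "((\<lambda>y. D f y b) has_derivative (\<lambda>v. D (\<lambda>z. D f z b) x v)) (at x)" for b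
    using smooth_has_derivative[OF smooth_directional[OF f]] .
  (* The value of the field is held fixed here; its variation adds the terms with D G below. *)
  have "((\<lambda>y. \<Sum>b\<in>B. r b (G x) *\<^sub>R D f y b) has_derivative
      (\<lambda>v. \<Sum>b\<in>B. r b (G x) *\<^sub>R D (\<lambda>z. D f z b) x v)) (at x)"
    by (intro has_derivative_sum has_derivative_scaleR_right Df)
  then have fixed: "D (\<lambda>z. D f z (G x)) x = (\<lambda>v. \<Sum>b\<in>B. r b (G x) *\<^sub>R D (\<lambda>z. D f z b) x v)"
    unfolding expand[symmetric] by (rule D_eqI)
  have "((\<lambda>y. \<Sum>b\<in>B. r b (G y) *\<^sub>R D f y b) has_derivative
      (\<lambda>v. \<Sum>b\<in>B. r b (G x) *\<^sub>R D (\<lambda>z. D f z b) x v + r b (D G x v) *\<^sub>R D f x b)) (at x)"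
    by (intro has_derivative_sum has_derivative_scaleR Df bounded_linear.has_derivative[OF bl]
        smooth_has_derivative[OF G])
  then show "((\<lambda>y. D f y (G y)) has_derivative
      (\<lambda>v. D (\<lambda>z. D f z (G x)) x v + D f x (D G x v))) (at x)"
    unfolding eq fixed by (simp add: sum.distrib expand[symmetric])
qed

section \<open>Brackets induced by a representation as vector fields\<close>

text \<open>The map \<open>\<Gamma>\<close> lets functions act on functions as vector fields, and it turns the bracket into the
  bracket of these fields. Bilinearity and antisymmetry are immediate. In the cyclic sum of the
  Jacobi identity the terms with two first derivatives cancel because the field of a bracket is
  the bracket of the fields, and the terms with a second derivative cancel because second
  derivatives are symmetric. As \<open>\<Gamma>\<close> may have a kernel, the identity does
  not follow from the one for vector fields.\<close>

lemma lie_algebra_of_representation: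
  fixes br :: "('a::real_normed_vector \<Rightarrow> 'b::real_normed_vector) \<Rightarrow> ('a \<Rightarrow> 'b) \<Rightarrow> 'a \<Rightarrow> 'b"
    and \<Gamma> :: "('a \<Rightarrow> 'b) \<Rightarrow> 'a \<Rightarrow> 'a"
  assumes fd: "\<exists>B :: 'a set. finite B \<and> span B = UNIV"
    and br: "\<And>f g x. f \<in> smooth_maps \<Longrightarrow> g \<in> smooth_maps \<Longrightarrow> br f g x = D f x (\<Gamma> g x) - D g x (\<Gamma> f x)"
    and smooth: "\<And>f. f \<in> smooth_maps \<Longrightarrow> \<Gamma> f \<in> smooth_maps"
    and add: "\<And>f g x. \<Gamma> (f + g) x = \<Gamma> f x + \<Gamma> g x"
    and scale: "\<And>c f x. \<Gamma> (c *\<^sub>R f) x = c *\<^sub>R \<Gamma> f x"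
    and hom: "\<And>f g. f \<in> smooth_maps \<Longrightarrow> g \<in> smooth_maps \<Longrightarrow> \<Gamma> (br f g) = vf_bracket (\<Gamma> f) (\<Gamma> g)"
  shows "lie_algebra smooth_maps br"
proof
  show sub: "subspace (smooth_maps :: ('a \<Rightarrow> 'b) set)" by (rule subspace_smooth_maps)
  note closed = subspace_add[OF sub] subspace_scale[OF sub]
  have br_fun: "br f g = (\<lambda>x. D f x (\<Gamma> g x) - D g x (\<Gamma> f x))"
    if "f \<in> smooth_maps" "g \<in> smooth_maps" for f g
    using br that by blast
  show smooth_br: "br f g \<in> smooth_maps" if "f \<in> smooth_maps" "g \<in> smooth_maps" for f g
    unfolding br_fun[OF that] using that by (intro smooth_diff smooth_along_field fd smooth)
  show "br (f + g) h = br f h + br g h"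
    if "f \<in> smooth_maps" "g \<in> smooth_maps" "h \<in> smooth_maps" for f g h
    using that by (intro ext) (simp add: br closed D_add add linear_add[OF smooth_linear_D])
  show "br f (g + h) = br f g + br f h"
    if "f \<in> smooth_maps" "g \<in> smooth_maps" "h \<in> smooth_maps" for f g h
    using that by (intro ext) (simp add: br closed D_add add linear_add[OF smooth_linear_D])
  show "br (c *\<^sub>R f) g = c *\<^sub>R br f g" if "f \<in> smooth_maps" "g \<in> smooth_maps" for c f g
    using that by (intro ext) (simp add: br closed D_scaleR scale linear_cmul[OF smooth_linear_D]
        scaleR_diff_right scaleR_fun_def[of c "br f g"])
  show "br f (c *\<^sub>R g) = c *\<^sub>R br f g" if "f \<in> smooth_maps" "g \<in> smooth_maps" for c f g
    using that by (intro ext) (simp add: br closed D_scaleR scale linear_cmul[OF smooth_linear_D]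
        scaleR_diff_right scaleR_fun_def[of c "br f g"])
  show "br f f = 0" if "f \<in> smooth_maps" for f
    using that by (intro ext) (simp add: br)
  have sym: "D (\<lambda>z. D f z v) x w = D (\<lambda>z. D f z w) x v" if "f \<in> smooth_maps" for f :: "'a \<Rightarrow> 'b" and x v w
  proof (rule second_derivative_symmetric)
    show "f differentiable (at y)" "(\<lambda>z. D f z u) differentiable (at y)" for y u
      using that smooth_has_derivative smooth_directional differentiableI by blast+
    show "continuous_on UNIV (\<lambda>y. D (\<lambda>z. D f z u) y u')" for u u'
      using smooth_mapsD[OF smooth_directional[OF smooth_directional[OF that]], of 0] by simp
  qed
  have nested: "br f (br g h) x =
      D f x (D (\<Gamma> g) x (\<Gamma> h x)) - D f x (D (\<Gamma> h) x (\<Gamma> g x))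
      - (D (\<lambda>z. D g z (\<Gamma> h x)) x (\<Gamma> f x) + D g x (D (\<Gamma> h) x (\<Gamma> f x))
         - (D (\<lambda>z. D h z (\<Gamma> g x)) x (\<Gamma> f x) + D h x (D (\<Gamma> g) x (\<Gamma> f x))))"
    if S: "f \<in> smooth_maps" "g \<in> smooth_maps" "h \<in> smooth_maps" for f g h x
  proof -
    have "D (br g h) x = (\<lambda>v. D (\<lambda>z. D g z (\<Gamma> h x)) x v + D g x (D (\<Gamma> h) x v)
         - (D (\<lambda>z. D h z (\<Gamma> g x)) x v + D h x (D (\<Gamma> g) x v)))"
      unfolding br_fun[OF S(2,3)]
      by (intro D_eqI has_derivative_diff has_derivative_along_field fd smooth S)
    then show ?thesis
      using S by (simp add: br[OF S(1) smooth_br] hom vf_bracket_def linear_diff[OF smooth_linear_D])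
  qed
  show "br f (br g h) + br g (br h f) + br h (br f g) = 0"
    if S: "f \<in> smooth_maps" "g \<in> smooth_maps" "h \<in> smooth_maps" for f g h
  proof
    fix x
    show "(br f (br g h) + br g (br h f) + br h (br f g)) x = 0 x"
      using S sym[OF S(1), of "\<Gamma> g x" x "\<Gamma> h x"] sym[OF S(2), of "\<Gamma> h x" x "\<Gamma> f x"]
        sym[OF S(3), of "\<Gamma> f x" x "\<Gamma> g x"]
      by (simp add: nested)
  qed
qed

lemma lie_algebra_vector_fields:
  assumes "\<exists>B :: 'a::real_normed_vector set. finite B \<and> span B = UNIV"
  shows "lie_algebra (smooth_maps :: ('a \<Rightarrow> 'a) set) vf_bracket"
  by (rule lie_algebra_of_representation[where \<Gamma> = "\<lambda>F. F"])
     (use assms in \<open>auto simp: vf_bracket_def scaleR_fun_def\<close>)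

section \<open>Coupled cell network vector fields\<close>

lemma bounded_linear_axis: "bounded_linear (axis i :: 'v::real_normed_vector \<Rightarrow> 'v ^ 'n::finite)"
proof (rule bounded_linear_intro)
  show "axis i (x + y) = (axis i x + axis i y :: 'v ^ 'n)" for x y :: 'v
    by (simp add: vec_eq_iff axis_def)
  show "axis i (c *\<^sub>R x) = (c *\<^sub>R axis i x :: 'v ^ 'n)" for c and x :: 'v
    by (simp add: vec_eq_iff axis_def)
  show "norm (axis i x :: 'v ^ 'n) \<le> norm x * 1" for x :: 'v
  proof -
    have "norm (axis i x :: 'v ^ 'n) \<le> (\<Sum>k\<in>UNIV. norm ((axis i x :: 'v ^ 'n) $ k))"
      unfolding norm_vec_def by (rule L2_set_le_sum) simp
    also have "\<dots> = (\<Sum>k\<in>UNIV. if k = i then norm x else 0)"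
      by (intro sum.cong) (auto simp: axis_def)
    finally show ?thesis by simp
  qed
qed

lemma sum_axis_nth: "(\<Sum>i\<in>UNIV. axis i (X $ i)) = (X :: 'v::real_normed_vector ^ 'n::finite)"
proof -
  have "(\<Sum>i\<in>UNIV. (axis i (X $ i) :: 'v ^ 'n) $ k) = (\<Sum>i\<in>UNIV. if i = k then X $ k else 0)" for k
    by (intro sum.cong) (auto simp: axis_def)
  then show ?thesis by (simp add: vec_eq_iff)
qed

lemma finite_dimensional_vec:
  assumes "\<exists>B :: 'v::real_normed_vector set. finite B \<and> span B = UNIV"
  shows "\<exists>B :: ('v ^ 'n::finite) set. finite B \<and> span B = UNIV"
proof -
  obtain B :: "'v set" where B: "finite B" "span B = UNIV" using assms by blast
  define C :: "('v ^ 'n) set" where "C = (\<Union>i. axis i ` B)"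
  have "axis i v \<in> span C" for i v
  proof -
    have "(axis i :: 'v \<Rightarrow> 'v ^ 'n) ` UNIV = span (axis i ` B)"
      using linear_span_image[OF bounded_linear.linear[OF bounded_linear_axis], of i B] B(2) by simp
    also have "\<dots> \<subseteq> span C" by (intro span_mono) (auto simp: C_def)
    finally show ?thesis by blast
  qed
  then have "X \<in> span C" for X
    using span_sum[of UNIV "\<lambda>i. axis i (X $ i)" C] by (simp add: sum_axis_nth)
  moreover have "finite C" using B by (simp add: C_def)
  ultimately show ?thesis by blast
qed

text \<open>The projection that extracts the states on which cell \<open>i\<close> depends. For \<open>\<tau> = sigma_tilde \<sigma>\<close> it is
  the map \<open>A_map \<sigma> i\<close>, which makes the cells of the fundamental network, on \<open>V^n\<close>, a special case.\<close>

definition cell_input :: "('n \<Rightarrow> 'k \<Rightarrow> 'k) \<Rightarrow> 'k \<Rightarrow> 'v ^ 'k \<Rightarrow> 'v ^ 'n" where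
  "cell_input \<tau> i x = (\<chi> j. x $ \<tau> j i)"

lemma bounded_linear_cell_input:
  "bounded_linear (cell_input \<tau> i :: 'v::real_normed_vector ^ 'k::finite \<Rightarrow> 'v ^ 'n::finite)"
proof -
  have "cell_input \<tau> i = (\<lambda>x :: 'v ^ 'k. (\<Sum>j\<in>UNIV. axis j (x $ \<tau> j i)) :: 'v ^ 'n)"
    by (intro ext, subst sum_axis_nth[symmetric]) (simp add: cell_input_def)
  then show ?thesis
    by (auto intro!: bounded_linear_sum bounded_linear_compose[OF bounded_linear_axis bounded_linear_vec_nth])
qed

lemma network_vf_nth: "network_vf \<tau> f x $ i = f (cell_input \<tau> i x)"
  by (simp add: network_vf_def cell_input_def)

lemma A_map_eq_cell_input: "A_map \<sigma> j = cell_input (sigma_tilde \<sigma>) j"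
  by (simp add: fun_eq_iff A_map_def cell_input_def)

lemma network_vf_eq_sum:
  fixes f :: "'v::real_normed_vector ^ 'n::finite \<Rightarrow> 'v" and \<tau> :: "'n \<Rightarrow> 'k::finite \<Rightarrow> 'k"
  shows "network_vf \<tau> f = (\<lambda>x. \<Sum>i\<in>UNIV. axis i (f (cell_input \<tau> i x)))"
  by (intro ext, subst sum_axis_nth[symmetric]) (simp add: network_vf_nth)

lemma network_vf_smooth: "f \<in> smooth_maps \<Longrightarrow> network_vf \<tau> f \<in> smooth_maps"
  unfolding network_vf_eq_sum
  by (intro smooth_sum smooth_bounded_linear[OF bounded_linear_axis]
      smooth_compose_linear[OF bounded_linear_cell_input])

lemma network_vf_add: "network_vf \<tau> (f + g) = network_vf \<tau> f + network_vf \<tau> g"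
  by (simp add: fun_eq_iff vec_eq_iff network_vf_nth)

lemma network_vf_scaleR:
  fixes f :: "'v::real_normed_vector ^ 'n::finite \<Rightarrow> 'v"
  shows "network_vf \<tau> (c *\<^sub>R f) = c *\<^sub>R network_vf \<tau> f"
  by (simp add: fun_eq_iff vec_eq_iff network_vf_nth scaleR_fun_def)

lemma D_network_vf_nth:
  assumes f: "f \<in> smooth_maps"
  shows "D (network_vf \<tau> f) x v $ i = D f (cell_input \<tau> i x) (cell_input \<tau> i v)"
proof -
  have "((\<lambda>x. network_vf \<tau> f x $ i) has_derivative (\<lambda>v. D (network_vf \<tau> f) x v $ i)) (at x)"
    by (rule bounded_linear.has_derivative[OF bounded_linear_vec_nth])
       (rule smooth_has_derivative[OF network_vf_smooth[OF f]])
  moreover have "((\<lambda>x. network_vf \<tau> f x $ i) has_derivative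
      (\<lambda>v. D f (cell_input \<tau> i x) (cell_input \<tau> i v))) (at x)"
    unfolding network_vf_nth
    by (rule has_derivative_compose[OF bounded_linear_imp_has_derivative[OF bounded_linear_cell_input]
          smooth_has_derivative[OF f]])
  ultimately show ?thesis by (metis has_derivative_unique)
qed

lemma partial_deriv_eq_D_axis:
  fixes f :: "'v::real_normed_vector ^ 'n::finite \<Rightarrow> 'v"
  assumes f: "f \<in> smooth_maps"
  shows "partial_deriv j f X w = D f X (axis j w)"
proof -
  have line: "(\<chi> k. if k = j then t else X $ k) = X + axis j (t - X $ j)" for t
    by (auto simp: vec_eq_iff axis_def)
  have "((\<lambda>t. X + axis j (t - X $ j)) has_derivative (\<lambda>w. axis j w)) (at (X $ j))"
    by (auto intro!: derivative_eq_intros bounded_linear.has_derivative[OF bounded_linear_axis])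
  moreover have "(f has_derivative D f X) (at (X + axis j (X $ j - X $ j)))"
    using smooth_has_derivative[OF f] by (simp add: linear_0[OF bounded_linear.linear[OF bounded_linear_axis]])
  ultimately have "((\<lambda>t. f (X + axis j (t - X $ j))) has_derivative (\<lambda>w. D f X (axis j w))) (at (X $ j))"
    by (rule has_derivative_compose)
  then show ?thesis
    unfolding partial_deriv_def line by (simp add: D_eqI)
qed

text \<open>The partial derivatives add up to the total derivative, and the vectors \<open>g (A_map \<sigma> j X)\<close> to
  which they are applied are the components of the network vector field of \<open>g\<close> for the family
  \<open>sigma_tilde \<sigma>\<close>.\<close>

lemma sigma_bracket_eq:
  fixes f g :: "'v::real_normed_vector ^ 'n::finite \<Rightarrow> 'v"
  assumes f: "f \<in> smooth_maps" and g: "g \<in> smooth_maps"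
  shows "sigma_bracket \<sigma> f g X =
    D f X (network_vf (sigma_tilde \<sigma>) g X) - D g X (network_vf (sigma_tilde \<sigma>) f X)"
proof -
  have total: "(\<Sum>j\<in>UNIV. partial_deriv j h X (Y $ j)) = D h X Y"
    if "h \<in> smooth_maps" for h :: "'v ^ 'n \<Rightarrow> 'v" and Y
  proof -
    have "(\<Sum>j\<in>UNIV. partial_deriv j h X (Y $ j)) = D h X (\<Sum>j\<in>UNIV. axis j (Y $ j))"
      by (simp only: partial_deriv_eq_D_axis[OF that] linear_sum[OF smooth_linear_D[OF that]])
    then show ?thesis by (simp only: sum_axis_nth)
  qed
  show ?thesis
    by (simp add: sigma_bracket_def A_map_eq_cell_input network_vf_nth[symmetric]
        sum_subtractf total f g)
qed

lemma sigma_sigma_tilde: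
  assumes "semigroup_family \<sigma>"
  shows "\<sigma> (sigma_tilde \<sigma> j k) = \<sigma> j \<circ> \<sigma> k"
proof -
  have "\<exists>!l. \<sigma> l = \<sigma> j \<circ> \<sigma> k"
    using assms unfolding semigroup_family_def by metis
  then show ?thesis unfolding sigma_tilde_def by (rule theI')
qed

text \<open>The maps \<open>sigma_tilde \<sigma> j\<close> are the left translations of the semigroup, whose associativity
  makes them compose as the maps \<open>\<sigma> j\<close> do.\<close>

lemma sigma_tilde_sigma_tilde:
  assumes "inj \<sigma>" "semigroup_family \<sigma>"
  shows "sigma_tilde \<sigma> (sigma_tilde \<sigma> j k) = sigma_tilde \<sigma> j \<circ> sigma_tilde \<sigma> k"
  using assms by (intro ext injD[OF assms(1)]) (simp add: sigma_sigma_tilde comp_assoc)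

text \<open>Any family \<open>\<tau>\<close> that composes according to the multiplication table of \<open>\<sigma>\<close> will do, so that the
  original network (\<open>\<tau> = \<sigma>\<close>) and the fundamental one (\<open>\<tau> = sigma_tilde \<sigma>\<close>) are treated at once.
  The reason is that each \<open>cell_input \<tau> i\<close> intertwines the vector field of \<open>h\<close> on the network of
  \<open>\<tau>\<close> with its vector field on the fundamental network: both sides have \<open>j\<close>-th component
  \<open>h (cell_input \<tau> (\<tau> j i) x)\<close>. By the chain rule the \<open>i\<close>-th component of the bracket of vector
  fields is therefore \<open>sigma_bracket \<sigma> f g\<close> evaluated at the input of cell \<open>i\<close>.\<close>

lemma network_vf_sigma_bracket:
  fixes f g :: "'v::real_normed_vector ^ 'n::finite \<Rightarrow> 'v" and \<tau> :: "'n \<Rightarrow> 'k::finite \<Rightarrow> 'k"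
  assumes rep: "\<And>j k. \<tau> (sigma_tilde \<sigma> j k) = \<tau> j \<circ> \<tau> k"
    and f: "f \<in> smooth_maps" and g: "g \<in> smooth_maps"
  shows "network_vf \<tau> (sigma_bracket \<sigma> f g) = vf_bracket (network_vf \<tau> f) (network_vf \<tau> g)"
proof -
  have intertwine: "network_vf (sigma_tilde \<sigma>) h (cell_input \<tau> i x) = cell_input \<tau> i (network_vf \<tau> h x)"
    for h :: "'v ^ 'n \<Rightarrow> 'v" and i x
    by (simp add: vec_eq_iff network_vf_def cell_input_def rep)
  show ?thesis
    by (simp add: fun_eq_iff vec_eq_iff vf_bracket_def network_vf_nth sigma_bracket_eq f g
        intertwine D_network_vf_nth)
qed

theorem lemma5p2:
  fixes \<sigma> :: "'n::finite \<Rightarrow> 'm::finite \<Rightarrow> 'm"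
  assumes finite_dim: "\<exists>B :: 'v::real_normed_vector set. finite B \<and> span B = UNIV"
    and distinct_maps: "inj \<sigma>"
    and semigroup: "semigroup_family \<sigma>"
  shows "lie_algebra (smooth_maps :: ('v ^ 'n \<Rightarrow> 'v) set) (sigma_bracket \<sigma>) \<and>
         lie_algebra_hom
           (smooth_maps :: ('v ^ 'n \<Rightarrow> 'v) set) (sigma_bracket \<sigma>)
           (smooth_maps :: ('v ^ 'm \<Rightarrow> 'v ^ 'm) set) vf_bracket
           (network_vf \<sigma>)"
proof -
  have src: "lie_algebra (smooth_maps :: ('v ^ 'n \<Rightarrow> 'v) set) (sigma_bracket \<sigma>)"
  proof (rule lie_algebra_of_representation[where \<Gamma> = "network_vf (sigma_tilde \<sigma>)"])
    show "network_vf (sigma_tilde \<sigma>) (sigma_bracket \<sigma> f g) =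
        vf_bracket (network_vf (sigma_tilde \<sigma>) f) (network_vf (sigma_tilde \<sigma>) g)"
      if "f \<in> smooth_maps" "g \<in> smooth_maps" for f g :: "'v ^ 'n \<Rightarrow> 'v"
      using network_vf_sigma_bracket[OF sigma_tilde_sigma_tilde[OF distinct_maps semigroup] that] .
  qed (simp_all add: finite_dimensional_vec[OF finite_dim] sigma_bracket_eq network_vf_smooth
      network_vf_add network_vf_scaleR scaleR_fun_def[of _ "network_vf _ _"])
  have tgt: "lie_algebra (smooth_maps :: ('v ^ 'm \<Rightarrow> 'v ^ 'm) set) vf_bracket"
    by (rule lie_algebra_vector_fields[OF finite_dimensional_vec[OF finite_dim]])
  have "lie_algebra_hom_axioms (smooth_maps :: ('v ^ 'n \<Rightarrow> 'v) set) (sigma_bracket \<sigma>)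
      smooth_maps vf_bracket (network_vf \<sigma>)"
    by unfold_locales
       (simp_all add: network_vf_smooth network_vf_add network_vf_scaleR
          network_vf_sigma_bracket[OF sigma_sigma_tilde[OF semigroup]])
  with src tgt show ?thesis by (simp add: lie_algebra_hom_def)
qed

end
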